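(* Let $(u^*,v^* )$ be a global minimum of the reduced problem $$\min_{u,v}\ \Psi(u,v)\quad\text{s.t.}\quad u\in\Sigma\subset U_t,\ v\in\Gamma\subset V_t .$$ Assume that the value function $\eta(v)=\inf_{u\in\Sigma}\Psi(u,v)$, $\eta\colon V_t\to\mathbb{R}\cup\{-\infty,+\infty\}$, satisfies: for all $\delta>0$ there exists a constant $L$ such that $$|\eta(v^* )-\eta(v)|\le L\int_0^T|v^*(t)-v(t)|_{l_1}\,dt$$ for all $v\in V_t$ with $\int_0^T|v^*(t)-v(t)|_{l_1}\,dt\le\delta$. Then there exists a penalty parameter $\bar\rho$ such that, for all $\rho\ge\bar\rho$, $([u^*,v^*],v^* )$ is a p-minimum of the penalty problem $$\min_{u,v,\tilde v}\ \Psi_\rho(u,v,\tilde v):=\Psi(u,v)+\rho\int_0^T|v(t)-\tilde v(t)|_{l_1}\,dt\quad\text{s.t.}\quad u\in\Sigma,\ v\in V_t,\ \tilde v\in\Gamma .$$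
   Context: Setting: $T>0$, $M\in\mathbb{N}$, $p\in(0,\infty]$; $Y$ and $U$ are Banach spaces; $U_t=L^p(0,T;U)$, $V_t=L^\infty(0,T;\{0,1\}^M)$; $\Sigma\subset U_t$ and $\Gamma\subset V_t$ are given sets; $y_0\in Y$; $A$ is a densely defined linear operator on $Y$; $f\colon Y\times U\times\{0,1\}^M\to Y$; $|w|_{l_1}=\sum_{i=1}^M|w_i|$. Standing assumption: $A$ generates a strongly continuous semigroup $(e^{tA})_{t\ge0}$ on $Y$, and there is $K>0$ such that for all $v\in\{0,1\}^M$: (i) $(y,u)\mapsto f(y,u,v)$ is continuous on $Y\times U$; (ii) $\|f(y,u,v)\|_Y\le K(1+\|y\|_Y)$ for all $y\in Y$, $u\in U$; (iii) $\|f(y,u,v)-f(z,u,v)\|_Y\le K\|y-z\|_Y$ for all $y,z\in Y$, $u\in U$. Moreover $\Phi\colon Y\to\mathbb{R}$ is Lipschitz continuous on bounded subsets of $Y$. Under this assumption, for $u\in U_t$, $v\in V_t$, $y(\cdot;u,v)\in C([0,T];Y)$ denotes the unique mild solution of $\dot y(t)=Ay(t)+f(y(t),u(t),v(t))$, $y(0)=y_0$, i.e. $y(t)=e^{tA}y_0+\int_0^te^{(t-\tau)A}f(y(\tau),u(\tau),v(\tau))\,d\tau$, and $\Psi(u,v):=\Phi(y(T;u,v))$. p-minimum: a feasible point $([u^*,v^*],\tilde v^* )$ of the penalty problem is a p-minimum (partial minimum with respect to the two blocks $(u,v)$ and $\tilde v$) if $\Psi_\rho(u^*,v^*,\tilde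 v)\ge\Psi_\rho(u^*,v^*,\tilde v^* )$ for all $\tilde v$ such that $(u^*,v^*,\tilde v)$ is feasible (i.e. $\tilde v\in\Gamma$), and $\Psi_\rho(u,v,\tilde v^* )\ge\Psi_\rho(u^*,v^*,\tilde v^* )$ for all $(u,v)$ such that $(u,v,\tilde v^* )$ is feasible (i.e. $u\in\Sigma$, $v\in V_t$). *)

theory Defs
  imports "HOL-Analysis.Analysis"
begin

text \<open>
  Lebesgue--Bochner spaces.  The state space and the control space are arbitrary Banach spaces, so
  the library's \<^const>\<open>has_bochner_integral\<close>, which is restricted to second countable value spaces,
  is not applicable.  The following is the same construction with Borel measurability replaced
  by strong measurability.
\<close>

definition strongly_measurable :: "'a measure \<Rightarrow> ('a \<Rightarrow> 'b::real_normed_vector) \<Rightarrow> bool" where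
  "strongly_measurable M g \<longleftrightarrow>
     (\<exists>s. (\<forall>n. simple_function M (s n)) \<and> (AE x in M. (\<lambda>n. s n x) \<longlonglongrightarrow> g x))"

definition has_strong_bochner_integral ::
    "'a measure \<Rightarrow> ('a \<Rightarrow> 'b::real_normed_vector) \<Rightarrow> 'b \<Rightarrow> bool" where
  "has_strong_bochner_integral M g I \<longleftrightarrow>
     strongly_measurable M g \<and>
     (\<exists>s. (\<forall>n. Bochner_Integration.simple_bochner_integrable M (s n)) \<and>
          (\<lambda>n. \<integral>\<^sup>+x. ennreal (norm (g x - s n x)) \<partial>M) \<longlonglongrightarrow> 0 \<and>
          (\<lambda>n. Bochner_Integration.simple_bochner_integral M (s n)) \<longlonglongrightarrow> I)"

lemma has_bochner_integral_imp_strong: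
  assumes "has_bochner_integral M g I"
  shows "has_strong_bochner_integral M g I"
  using assms
proof cases
  case (1 s)
  from borel_measurable_implies_sequence_metric[OF 1(1)]
  obtain F where "\<forall>i. simple_function M (F i)" "\<forall>x\<in>space M. (\<lambda>i. F i x) \<longlonglongrightarrow> g x"
    by blast
  then have "strongly_measurable M g"
    unfolding strongly_measurable_def by (intro exI[of _ F]) auto
  with 1 show ?thesis
    unfolding has_strong_bochner_integral_def by auto
qed

text \<open>
  Elements of $L^p$ are represented by functions; a set of equivalence classes is represented by
  any set of representatives.  All functionals below depend only on the classes.
\<close>

definition Lp_functions :: "ennreal \<Rightarrow> 'a measure \<Rightarrow> ('a \<Rightarrow> 'b::real_normed_vector) set" where
  "Lp_functions p M = {g. strongly_measurable M g \<and>
     (if p = \<infinity> then \<exists>C. AE x in M. norm (g x) \<le> C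
      else (\<integral>\<^sup>+x. ennreal (norm (g x) powr enn2real p) \<partial>M) < \<infinity>)}"

definition continuous_controls :: "ennreal \<Rightarrow> real \<Rightarrow> (real \<Rightarrow> 'u::real_normed_vector) set" where
  "continuous_controls p T = Lp_functions p (lebesgue_on {0<..<T})"

definition binary_vectors :: "(real ^ 'm) set" where
  "binary_vectors = {w. \<forall>i. w $ i \<in> {0, 1}}"

definition switching_controls :: "real \<Rightarrow> (real \<Rightarrow> real ^ 'm) set" where
  "switching_controls T =
     {v \<in> Lp_functions \<infinity> (lebesgue_on {0<..<T}). AE t in lebesgue_on {0<..<T}. v t \<in> binary_vectors}"

definition l1_norm :: "real ^ 'm \<Rightarrow> real" where
  "l1_norm w = (\<Sum>i\<in>UNIV. \<bar>w $ i\<bar>)"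

definition L1_dist :: "real \<Rightarrow> (real \<Rightarrow> real ^ 'm) \<Rightarrow> (real \<Rightarrow> real ^ 'm) \<Rightarrow> real" where
  "L1_dist T v w = (\<integral>t. l1_norm (v t - w t) \<partial>lebesgue_on {0<..<T})"


definition densely_defined_linear :: "'y::real_normed_vector set \<Rightarrow> ('y \<Rightarrow> 'y) \<Rightarrow> bool" where
  "densely_defined_linear D A \<longleftrightarrow>
     subspace D \<and> closure D = UNIV \<and>
     (\<forall>x\<in>D. \<forall>y\<in>D. A (x + y) = A x + A y) \<and>
     (\<forall>c. \<forall>x\<in>D. A (c *\<^sub>R x) = c *\<^sub>R A x)"

text \<open>Values of a semigroup at negative times are irrelevant throughout.\<close>

definition C0_semigroup :: "(real \<Rightarrow> 'y::real_normed_vector \<Rightarrow> 'y) \<Rightarrow> bool" where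
  "C0_semigroup S \<longleftrightarrow>
     (\<forall>t\<ge>0. bounded_linear (S t)) \<and>
     (\<forall>y. S 0 y = y) \<and>
     (\<forall>s\<ge>0. \<forall>t\<ge>0. \<forall>y. S (s + t) y = S s (S t y)) \<and>
     (\<forall>y. ((\<lambda>t. S t y) \<longlongrightarrow> y) (at_right 0))"

definition generates_C0_semigroup ::
    "'y::real_normed_vector set \<Rightarrow> ('y \<Rightarrow> 'y) \<Rightarrow> (real \<Rightarrow> 'y \<Rightarrow> 'y) \<Rightarrow> bool" where
  "generates_C0_semigroup D A S \<longleftrightarrow>
     C0_semigroup S \<and>
     D = {y. \<exists>z. ((\<lambda>h. (S h y - y) /\<^sub>R h) \<longlongrightarrow> z) (at_right 0)} \<and>
     (\<forall>y\<in>D. ((\<lambda>h. (S h y - y) /\<^sub>R h) \<longlongrightarrow> A y) (at_right 0))"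

definition admissible_nonlinearity ::
    "('y::real_normed_vector \<Rightarrow> 'u::real_normed_vector \<Rightarrow> real ^ 'm \<Rightarrow> 'y) \<Rightarrow> bool" where
  "admissible_nonlinearity f \<longleftrightarrow>
     (\<exists>K>0. \<forall>v\<in>binary_vectors.
        continuous_on UNIV (\<lambda>(y, u). f y u v) \<and>
        (\<forall>y u. norm (f y u v) \<le> K * (1 + norm y)) \<and>
        (\<forall>y z u. norm (f y u v - f z u v) \<le> K * norm (y - z)))"

definition lipschitz_on_bounded_sets :: "('y::real_normed_vector \<Rightarrow> real) \<Rightarrow> bool" where
  "lipschitz_on_bounded_sets \<Phi> \<longleftrightarrow> (\<forall>B. bounded B \<longrightarrow> (\<exists>L. L-lipschitz_on B \<Phi>))"

definition mild_solution ::
    "(real \<Rightarrow> 'y \<Rightarrow> 'y) \<Rightarrow> ('y \<Rightarrow> 'u \<Rightarrow> real ^ 'm \<Rightarrow> 'y) \<Rightarrow> real \<Rightarrow> 'y::banach \<Rightarrow>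
     (real \<Rightarrow> 'u) \<Rightarrow> (real \<Rightarrow> real ^ 'm) \<Rightarrow> (real \<Rightarrow> 'y) \<Rightarrow> bool" where
  "mild_solution S f T y0 u v y \<longleftrightarrow>
     continuous_on {0..T} y \<and>
     (\<forall>t\<in>{0..T}. \<exists>I.
        has_strong_bochner_integral (lebesgue_on {0..t}) (\<lambda>\<tau>. S (t - \<tau>) (f (y \<tau>) (u \<tau>) (v \<tau>))) I \<and>
        y t = S t y0 + I)"

text \<open>Mild solutions are unique on $[0,T]$ only; extensionality fixes the values elsewhere.\<close>

definition mild_state ::
    "(real \<Rightarrow> 'y \<Rightarrow> 'y) \<Rightarrow> ('y \<Rightarrow> 'u \<Rightarrow> real ^ 'm \<Rightarrow> 'y) \<Rightarrow> real \<Rightarrow> 'y::banach \<Rightarrow>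
     (real \<Rightarrow> 'u) \<Rightarrow> (real \<Rightarrow> real ^ 'm) \<Rightarrow> (real \<Rightarrow> 'y)" where
  "mild_state S f T y0 u v = (THE y. y \<in> extensional {0..T} \<and> mild_solution S f T y0 u v y)"

definition reduced_cost ::
    "(real \<Rightarrow> 'y \<Rightarrow> 'y) \<Rightarrow> ('y \<Rightarrow> 'u \<Rightarrow> real ^ 'm \<Rightarrow> 'y) \<Rightarrow> real \<Rightarrow> 'y::banach \<Rightarrow> ('y \<Rightarrow> real) \<Rightarrow>
     (real \<Rightarrow> 'u) \<Rightarrow> (real \<Rightarrow> real ^ 'm) \<Rightarrow> real" where
  "reduced_cost S f T y0 \<Phi> u v = \<Phi> (mild_state S f T y0 u v T)"

definition value_function ::
    "('a \<Rightarrow> 'b \<Rightarrow> real) \<Rightarrow> 'a set \<Rightarrow> 'b \<Rightarrow> ereal" where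
  "value_function \<Psi> \<Sigma> v = (INF u\<in>\<Sigma>. ereal (\<Psi> u v))"

definition penalty_cost ::
    "('a \<Rightarrow> (real \<Rightarrow> real ^ 'm) \<Rightarrow> real) \<Rightarrow> real \<Rightarrow> real \<Rightarrow>
     'a \<times> (real \<Rightarrow> real ^ 'm) \<Rightarrow> (real \<Rightarrow> real ^ 'm) \<Rightarrow> real" where
  "penalty_cost \<Psi> T \<rho> = (\<lambda>(u, v) w. \<Psi> u v + \<rho> * L1_dist T v w)"

definition penalty_feasible ::
    "'a set \<Rightarrow> 'b set \<Rightarrow> 'b set \<Rightarrow> 'a \<times> 'b \<Rightarrow> 'b \<Rightarrow> bool" where
  "penalty_feasible \<Sigma> V \<Gamma> = (\<lambda>(u, v) w. u \<in> \<Sigma> \<and> v \<in> V \<and> w \<in> \<Gamma>)"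

definition partial_minimum :: "('a \<Rightarrow> 'b \<Rightarrow> real) \<Rightarrow> ('a \<Rightarrow> 'b \<Rightarrow> bool) \<Rightarrow> 'a \<Rightarrow> 'b \<Rightarrow> bool" where
  "partial_minimum F feas x w \<longleftrightarrow>
     feas x w \<and>
     (\<forall>w'. feas x w' \<longrightarrow> F x w' \<ge> F x w) \<and>
     (\<forall>x'. feas x' w \<longrightarrow> F x' w \<ge> F x w)"

end

theory Submission
  imports Defs
begin

text \<open>
  Exact penalization rests on the fact that the set of switching controls is bounded in \<open>L\<^sup>1\<close>: any
  two of them differ by at most the number of components at each time, hence by at most
  \<open>T\<close> times that number in the integrated distance (\<open>L1_dist_switching_controls_le\<close>).
  Choosing \<open>\<delta>\<close> as this diameter turns the local Lipschitz estimate for the value function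
  at \<open>v\<^sup>*\<close> into an estimate that holds for every switching control, with one constant \<open>L\<close>.

  Since \<open>u\<^sup>*\<close> is optimal for the control \<open>v\<^sup>*\<close>, the value function at \<open>v\<^sup>*\<close> is the
  finite number \<open>\<Psi> u\<^sup>* v\<^sup>*\<close>. Therefore, for every \<open>u \<in> \<Sigma>\<close> and every switching control \<open>v\<close>,
  \<open>\<Psi> u v \<ge> \<eta> v \<ge> \<Psi> u\<^sup>* v\<^sup>* - L * d v\<close>, where \<open>d v\<close> is the distance from \<open>v\<^sup>*\<close> to \<open>v\<close>,
  and a penalty parameter of at least \<open>L\<close> pays for the possible decrease
  (\<open>exact_penalty_lower_bound\<close>). This is minimality in the block \<open>(u, v)\<close>. Minimality in the
  block of the auxiliary control holds because the penalty term is nonnegative and vanishes at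
  \<open>(v\<^sup>*, v\<^sup>*)\<close>.
\<close>

lemma L1_dist_nonneg: "L1_dist T v w \<ge> 0"
  unfolding L1_dist_def l1_norm_def by (intro integral_nonneg_AE AE_I2 sum_nonneg) simp

lemma L1_dist_self [simp]: "L1_dist T v v = 0"
  by (simp add: L1_dist_def l1_norm_def)

lemma L1_dist_commute: "L1_dist T v w = L1_dist T w v"
  by (simp add: L1_dist_def l1_norm_def abs_minus_commute)

lemma l1_norm_diff_binary_le:
  fixes v w :: "real ^ 'm"
  assumes "v \<in> binary_vectors" "w \<in> binary_vectors"
  shows "l1_norm (v - w) \<le> real CARD('m)"
proof -
  have "\<bar>(v - w) $ i\<bar> \<le> 1" for i
    using assms[unfolded binary_vectors_def, simplified, rule_format, of i] by auto
  then show ?thesis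
    unfolding l1_norm_def using sum_bounded_above[of UNIV "\<lambda>i. \<bar>(v - w) $ i\<bar>" 1] by simp
qed

text \<open>
  A pointwise bound times the length of the time interval. The Bochner integral of a nonintegrable
  function is \<open>0\<close> by convention, so the case split on integrability takes the place of an argument
  from the strong measurability of the controls.
\<close>

lemma L1_dist_switching_controls_le:
  fixes v w :: "real \<Rightarrow> real ^ 'm"
  assumes "T \<ge> 0" "v \<in> switching_controls T" "w \<in> switching_controls T"
  shows "L1_dist T v w \<le> T * real CARD('m)"
proof (cases "integrable (lebesgue_on {0<..<T}) (\<lambda>t. l1_norm (v t - w t))")
  case True
  let ?M = "lebesgue_on {0<..<T}"
  have AE: "AE t in ?M. v t \<in> binary_vectors" "AE t in ?M. w t \<in> binary_vectors"
    using assms by (auto simp: switching_controls_def)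
  have "L1_dist T v w \<le> (\<integral>t. real CARD('m) \<partial>?M)"
    unfolding L1_dist_def
  proof (rule integral_mono_AE[OF True])
    show "AE t in ?M. l1_norm (v t - w t) \<le> real CARD('m)"
      using AE by eventually_elim (rule l1_norm_diff_binary_le)
  qed (simp add: finite_measure.integrable_const finite_measure_lebesgue_on)
  also have "\<dots> = T * real CARD('m)"
    using \<open>T \<ge> 0\<close> by (simp add: measure_restrict_space)
  finally show ?thesis .
next
  case False
  then show ?thesis
    using \<open>T \<ge> 0\<close> by (simp add: L1_dist_def not_integrable_integral_eq)
qed

lemma value_function_eq_minimum:
  assumes "u0 \<in> \<Sigma>" "\<And>u. u \<in> \<Sigma> \<Longrightarrow> \<Psi> u0 v \<le> \<Psi> u v"
  shows "value_function \<Psi> \<Sigma> v = ereal (\<Psi> u0 v)"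
  unfolding value_function_def
  using assms by (intro antisym INF_lower INF_greatest) auto

text \<open>
  The extended-real estimate descends to the reals because it excludes the value \<open>-\<infinity>\<close> (the left
  side would be infinite), while \<open>u \<in> \<Sigma>\<close> excludes \<open>+\<infinity>\<close>. The constant \<open>L\<close> may be negative, so
  \<open>\<rho> * d\<close> dominates \<open>L * d\<close> by \<open>L \<le> \<rho>\<close> and the sign of \<open>d\<close> alone.
\<close>

lemma exact_penalty_lower_bound:
  assumes "value_function \<Psi> \<Sigma> v0 = ereal c"
    and "\<bar>value_function \<Psi> \<Sigma> v0 - value_function \<Psi> \<Sigma> v\<bar> \<le> ereal (L * d)"
    and "u \<in> \<Sigma>" and "0 \<le> d" and "L \<le> \<rho>"
  shows "c \<le> \<Psi> u v + \<rho> * d"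
proof -
  have upper: "value_function \<Psi> \<Sigma> v \<le> ereal (\<Psi> u v)"
    unfolding value_function_def using \<open>u \<in> \<Sigma>\<close> by (rule INF_lower)
  have "c \<le> \<Psi> u v + L * d"
    using assms(1,2) upper by (cases "value_function \<Psi> \<Sigma> v") auto
  also have "L * d \<le> \<rho> * d"
    using assms by (intro mult_right_mono)
  finally show ?thesis by simp
qed

theorem theorem2:
  fixes T :: real and p :: ennreal
    and D :: "'y::banach set" and A :: "'y \<Rightarrow> 'y" and S :: "real \<Rightarrow> 'y \<Rightarrow> 'y"
    and f :: "'y \<Rightarrow> 'u::banach \<Rightarrow> real ^ 'm \<Rightarrow> 'y"
    and y0 :: 'y and \<Phi> :: "'y \<Rightarrow> real"
    and \<Sigma> :: "(real \<Rightarrow> 'u) set" and \<Gamma> :: "(real \<Rightarrow> real ^ 'm) set"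
    and us :: "real \<Rightarrow> 'u" and vs :: "real \<Rightarrow> real ^ 'm"
  defines "\<Psi> \<equiv> reduced_cost S f T y0 \<Phi>"
  defines "\<eta> \<equiv> value_function \<Psi> \<Sigma>"
  assumes "T > 0" and "p > 0"
    and "densely_defined_linear D A" and "generates_C0_semigroup D A S"
    and "admissible_nonlinearity f" and "lipschitz_on_bounded_sets \<Phi>"
    and "\<Sigma> \<subseteq> continuous_controls p T" and "\<Gamma> \<subseteq> switching_controls T"
    and "is_arg_min (\<lambda>(u, v). \<Psi> u v) (\<lambda>(u, v). u \<in> \<Sigma> \<and> v \<in> \<Gamma>) (us, vs)"
    and "\<forall>\<delta>>0. \<exists>L::real. \<forall>v\<in>switching_controls T.
           L1_dist T vs v \<le> \<delta> \<longrightarrow> \<bar>\<eta> vs - \<eta> v\<bar> \<le> ereal (L * L1_dist T vs v)"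
  shows "\<exists>\<rho>bar::real. \<forall>\<rho>\<ge>\<rho>bar.
           partial_minimum (penalty_cost \<Psi> T \<rho>)
             (penalty_feasible \<Sigma> (switching_controls T) \<Gamma>) (us, vs) vs"
proof -
  from assms have us: "us \<in> \<Sigma>" and vs: "vs \<in> \<Gamma>"
    and opt: "\<And>u. u \<in> \<Sigma> \<Longrightarrow> \<Psi> us vs \<le> \<Psi> u vs"
    unfolding is_arg_min_def by (auto simp: not_less)
  from vs assms have vs_switching: "vs \<in> switching_controls T" by auto
  have \<eta>_vs: "\<eta> vs = ereal (\<Psi> us vs)"
    unfolding \<eta>_def by (rule value_function_eq_minimum[where \<Psi> = \<Psi>, OF us opt])
  \<comment> \<open>With the diameter of the switching controls as radius, the estimate becomes global.\<close>
  have "T * real CARD('m) > 0"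
    using \<open>T > 0\<close> by simp
  then obtain L where L: "\<And>v. v \<in> switching_controls T \<Longrightarrow> L1_dist T vs v \<le> T * real CARD('m) \<Longrightarrow>
      \<bar>\<eta> vs - \<eta> v\<bar> \<le> ereal (L * L1_dist T vs v)"
    using assms(12) by meson
  have lower: "\<Psi> us vs \<le> \<Psi> u v + \<rho> * L1_dist T v vs"
    if "u \<in> \<Sigma>" "v \<in> switching_controls T" "L \<le> \<rho>" for u v \<rho>
  proof -
    have "\<bar>\<eta> vs - \<eta> v\<bar> \<le> ereal (L * L1_dist T v vs)"
      using L[OF that(2)] L1_dist_switching_controls_le[OF _ vs_switching that(2)] \<open>T > 0\<close>
      by (simp add: L1_dist_commute)
    with \<eta>_vs show ?thesis
      unfolding \<eta>_def using that(1) L1_dist_nonneg that(3) by (rule exact_penalty_lower_bound)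
  qed
  \<comment> \<open>Nonnegativity of the parameter is what minimality in the auxiliary control requires.\<close>
  show ?thesis
  proof (intro exI[of _ "max 0 L"] allI impI)
    fix \<rho> assume "max 0 L \<le> \<rho>"
    then show "partial_minimum (penalty_cost \<Psi> T \<rho>)
        (penalty_feasible \<Sigma> (switching_controls T) \<Gamma>) (us, vs) vs"
      unfolding partial_minimum_def penalty_cost_def penalty_feasible_def
      using us vs vs_switching lower by (auto simp: L1_dist_nonneg)
  qed
qed

end
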